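(* Let $m,n$ be positive integers. If $\frac{n}{2}\le m\le n$, then \[ \dim(K_{1,m}\square K_{1,n})=n+\left\lfloor \frac{2m-n}{3}\right\rfloor . \]
   Context: All graphs are finite and simple; $d(u,v)$ is the length of a shortest path. For a connected graph $G$ and $W=\{w_1,\dots,w_k\}\subseteq V(G)$ (ordered), the metric representation of a vertex $v$ is $r(v|W)=(d(v,w_1),\dots,d(v,w_k))$. $W$ is a resolving set if distinct vertices of $G$ have distinct metric representations with respect to $W$. The metric dimension $\dim(G)$ is the minimum cardinality of a resolving set. $K_{1,n}$ is the star with $n$ leaves. The Cartesian product $G\square H$ has vertex set $V(G)\times V(H)$, with $(u,v)$ adjacent to $(u',v')$ iff $u=u'$ and $vv'\in E(H)$, or $v=v'$ and $uu'\in E(G)$.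
   Formalization: The case m = n = 1 is excluded: there the product is the 4-cycle, whose metric dimension is 2, while the stated formula gives 1. *)

theory Defs
  imports "Graph_Theory.Graph_Theory"
begin

text \<open>
  A finite simple graph is a \<^locale>\<open>pair_graph\<close>, i.e. a finite, loop-free, symmetric digraph
  whose arcs are ordered pairs of vertices; an undirected edge is represented by its two
  orientations. The predicate \<open>K\<^bsub>1,n\<^esub>\<close> of the library is used for stars.
\<close>

text \<open>Every arc has weight 1, so that the cost of a walk is its number of edges.\<close>

definition graph_dist :: "'a pair_pre_digraph \<Rightarrow> 'a \<Rightarrow> 'a \<Rightarrow> ereal" where
  "graph_dist G u v = wf_digraph.\<mu> (with_proj G) (\<lambda>_. 1) u v"

definition metric_rep :: "'a pair_pre_digraph \<Rightarrow> 'a \<Rightarrow> 'a list \<Rightarrow> ereal list" where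
  "metric_rep G v ws = map (\<lambda>w. graph_dist G v w) ws"

text \<open>The list \<open>ws\<close> is an ordering \<open>w\<^sub>1, \<dots>, w\<^sub>k\<close> of \<open>W\<close>; in particular, \<open>W\<close> is finite.\<close>

definition resolving_set :: "'a pair_pre_digraph \<Rightarrow> 'a set \<Rightarrow> bool" where
  "resolving_set G W \<longleftrightarrow> W \<subseteq> pverts G \<and>
     (\<exists>ws. distinct ws \<and> set ws = W \<and>
        (\<forall>u \<in> pverts G. \<forall>v \<in> pverts G. u \<noteq> v \<longrightarrow> metric_rep G u ws \<noteq> metric_rep G v ws))"

definition metric_dim :: "'a pair_pre_digraph \<Rightarrow> nat" where
  "metric_dim G = (LEAST k. \<exists>W. resolving_set G W \<and> card W = k)"

definition cartesian_product ::
    "'a pair_pre_digraph \<Rightarrow> 'b pair_pre_digraph \<Rightarrow> ('a \<times> 'b) pair_pre_digraph"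
    (infixr \<open>\<box>\<close> 75) where
  "G \<box> H = \<lparr> pverts = pverts G \<times> pverts H,
     parcs = {((u, v), (u', v')).
       u = u' \<and> u \<in> pverts G \<and> (v, v') \<in> parcs H \<or>
       v = v' \<and> v \<in> pverts H \<and> (u, u') \<in> parcs G} \<rparr>"

lemma pair_graph_cartesian_product:
  assumes "pair_graph G" "pair_graph H"
  shows "pair_graph (G \<box> H)"
proof -
  interpret G: pair_graph G by fact
  interpret H: pair_graph H by fact
  have sub: "parcs (G \<box> H) \<subseteq> pverts (G \<box> H) \<times> pverts (G \<box> H)"
    by (auto simp: cartesian_product_def dest: G.in_arcsD1 G.in_arcsD2 H.in_arcsD1 H.in_arcsD2)
  have fin: "finite (pverts (G \<box> H))"
    by (simp add: cartesian_product_def G.pair_finite_verts H.pair_finite_verts)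
  have fina: "finite (parcs (G \<box> H))"
    using sub fin by (meson finite_SigmaI finite_subset)
  have symG: "\<And>x y. (x, y) \<in> parcs G \<Longrightarrow> (y, x) \<in> parcs G"
    using G.pair_sym_arcs by (auto simp: symmetric_def dest: symD)
  have symH: "\<And>x y. (x, y) \<in> parcs H \<Longrightarrow> (y, x) \<in> parcs H"
    using H.pair_sym_arcs by (auto simp: symmetric_def dest: symD)
  have sm: "symmetric (with_proj (G \<box> H))"
    unfolding symmetric_def
    by (rule symI) (auto simp: cartesian_product_def intro: symG symH)
  have lf: "fst e \<noteq> snd e" if "e \<in> parcs (G \<box> H)" for e
    using that G.pair_no_loops H.pair_no_loops
    by (force simp: cartesian_product_def)
  show ?thesis
    using sub fin fina sm lf by unfold_locales auto
qed

lemma graph_dist_self: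
  assumes "pair_graph G" "v \<in> pverts G"
  shows "graph_dist G v v = 0"
proof -
  interpret pair_graph G by fact
  have "awalk v [] v" using assms by (simp add: awalk_def)
  then have "\<mu> (\<lambda>_. 1) v v \<le> 0"
    using min_cost_le_walk_cost[of v "[]" v "\<lambda>_. 1"] by (simp add: zero_ereal_def)
  moreover have "0 \<le> \<mu> (\<lambda>_. 1) v v"
    unfolding \<mu>_def by (rule INF_greatest) (simp add: awalk_cost_def sum_list_triv)
  ultimately show ?thesis by (simp add: graph_dist_def)
qed

lemma graph_dist_ge_1:
  assumes "pair_graph G" "u \<noteq> v"
  shows "1 \<le> graph_dist G u v"
proof -
  interpret pair_graph G by fact
  have "1 \<le> \<mu> (\<lambda>_. 1) u v"
    unfolding \<mu>_def
  proof (rule INF_greatest)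
    fix p assume "p \<in> {p. awalk u p v}"
    then have "p \<noteq> []" using assms by (auto simp: awalk_def)
    then show "1 \<le> ereal (awalk_cost (\<lambda>_. 1) p)"
      by (cases p) (simp_all add: awalk_cost_def sum_list_triv)
  qed
  then show ?thesis by (simp add: graph_dist_def)
qed

lemma graph_dist_arc:
  assumes "pair_graph G" "(u, v) \<in> parcs G"
  shows "graph_dist G u v = 1"
proof -
  interpret pair_graph G by fact
  have "awalk u [(u, v)] v" using assms by (auto simp: awalk_def dest: in_arcsD1)
  then have "\<mu> (\<lambda>_. 1) u v \<le> 1"
    using min_cost_le_walk_cost[of u "[(u, v)]" v "\<lambda>_. 1"] by (simp add: one_ereal_def)
  moreover have "u \<noteq> v" using pair_no_loops[OF assms(2)] by simp
  ultimately show ?thesis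
    using graph_dist_ge_1[OF assms(1), of u v] by (simp add: graph_dist_def)
qed

lemma resolving_set_pverts:
  assumes "pair_graph G"
  shows "resolving_set G (pverts G)"
proof -
  interpret pair_graph G by fact
  obtain ws where ws: "distinct ws" "set ws = pverts G"
    using finite_distinct_list[OF pair_finite_verts] by blast
  have "metric_rep G u ws \<noteq> metric_rep G v ws"
    if "u \<in> pverts G" "v \<in> pverts G" "u \<noteq> v" for u v
  proof
    assume "metric_rep G u ws = metric_rep G v ws"
    then have "graph_dist G u u = graph_dist G v u"
      using that ws by (auto simp: metric_rep_def)
    then show False
      using graph_dist_self[OF assms that(1)] graph_dist_ge_1[OF assms that(3)[symmetric]] by simp
  qed
  with ws show ?thesis by (auto simp: resolving_set_def)
qed

lemma metric_dim_attained:
  assumes "pair_graph G"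
  obtains W where "resolving_set G W" "card W = metric_dim G"
proof -
  have "\<exists>W. resolving_set G W \<and> card W = metric_dim G"
    unfolding metric_dim_def
    by (rule LeastI_ex) (use resolving_set_pverts[OF assms] in blast)
  then show ?thesis using that by blast
qed

text \<open>
  The formula \<open>dim(K\<^bsub>1,m\<^esub> \<box> K\<^bsub>1,n\<^esub>) = n + \<lfloor>(2m - n)/3\<rfloor>\<close> has the value 1 for \<open>m = n = 1\<close>, but
  the product is then a 4-cycle, whose metric dimension is not 1: a single landmark does not
  separate its two neighbours. The case \<open>m = n = 1\<close> is therefore excluded from the theorem.
\<close>

lemma metric_dim_K11_K11:
  fixes G :: "'a pair_pre_digraph" and H :: "'b pair_pre_digraph"
  assumes G: "K\<^bsub>1,1\<^esub> (with_proj G)" and H: "K\<^bsub>1,1\<^esub> (with_proj H)"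
  shows "metric_dim (G \<box> H) \<noteq> 1"
proof
  assume dim1: "metric_dim (G \<box> H) = 1"
  have pg: "pair_graph (G \<box> H)"
    using G H by (intro pair_graph_cartesian_product pair_graphI_complete_bipartite)
  obtain a a' where a: "pverts G = {a, a'}" "a \<noteq> a'" "parcs G = {(a, a'), (a', a)}"
    using G by (fastforce simp: complete_bipartite_digraph_pair_def card_1_singleton_iff)
  obtain b b' where b: "pverts H = {b, b'}" "b \<noteq> b'" "parcs H = {(b, b'), (b', b)}"
    using H by (fastforce simp: complete_bipartite_digraph_pair_def card_1_singleton_iff)
  obtain W where W: "resolving_set (G \<box> H) W" "card W = 1"
    using metric_dim_attained[OF pg] dim1 by metis
  then obtain w where w: "W = {w}" by (auto simp: card_1_singleton_iff)
  obtain ws where ws: "distinct ws" "set ws = {w}"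
    and res: "\<And>u v. u \<in> pverts (G \<box> H) \<Longrightarrow> v \<in> pverts (G \<box> H) \<Longrightarrow> u \<noteq> v \<Longrightarrow>
                metric_rep (G \<box> H) u ws \<noteq> metric_rep (G \<box> H) v ws"
    using W(1) unfolding resolving_set_def w by blast
  have wV: "w \<in> pverts (G \<box> H)" using W(1) w by (auto simp: resolving_set_def)
  obtain u v where uv: "u \<in> pverts (G \<box> H)" "v \<in> pverts (G \<box> H)" "u \<noteq> v"
      "(u, w) \<in> parcs (G \<box> H)" "(v, w) \<in> parcs (G \<box> H)"
  proof -
    obtain x y where xy: "w = (x, y)" by fastforce
    define x' where "x' = (if x = a then a' else a)"
    define y' where "y' = (if y = b then b' else b)"
    show ?thesis
      by (rule that[of "(x', y)" "(x, y')"])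
        (use wV a b in \<open>auto simp: xy x'_def y'_def cartesian_product_def\<close>)
  qed
  have "metric_rep (G \<box> H) u ws = metric_rep (G \<box> H) v ws"
    using ws(2) graph_dist_arc[OF pg uv(4)] graph_dist_arc[OF pg uv(5)]
    by (simp add: metric_rep_def)
  with res[OF uv(1-3)] show False by simp
qed

end

theory Submission
  imports Defs
begin

text \<open>
  Let the stars have centres \<open>c\<close>, \<open>d\<close> and leaf sets \<open>A\<close>, \<open>B\<close> with \<open>m\<close> and \<open>n\<close> elements. A set
  \<open>W\<close> of landmarks is read as a bipartite graph on \<open>A \<union> B\<close>: a landmark \<open>(a, b)\<close> with \<open>a \<in> A\<close>,
  \<open>b \<in> B\<close> is an edge, and a landmark \<open>(a, d)\<close> or \<open>(c, b)\<close> is a half-edge attached to a single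
  leaf. Distances in the product are sums of distances in the two stars, where they only take the
  values 0, 1, 2, so that resolvability becomes three combinatorial conditions
  (\<open>resolving_misses_at_most_one_leaf\<close>, \<open>resolving_no_isolated_edge\<close>, \<open>resolving_setI\<close>):

  \<^item> at most one leaf of \<open>A \<union> B\<close> lies on no landmark;
  \<^item> no edge is a connected component of its own (another landmark meets it);
  \<^item> for no \<open>a \<in> A\<close>, \<open>b \<in> B\<close> does every landmark contain exactly one of \<open>a\<close>, \<open>b\<close>.

  The third condition separates \<open>(a, b)\<close> from the centre \<open>(c, d)\<close>; it can only fail if two leaves
  meet all landmarks, which is impossible once there are many components. By the first two, the cheapest way to cover leaves is by paths with two edges,
  which cover three leaves each: if every leaf splits a unit of charge evenly among its landmarks,
  then a landmark receives at most \<open>1 + 1/2\<close>. Hence \<open>m + n - 1 \<le> (3/2) |W|\<close>, which is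
  \<open>|W| \<ge> \<lfloor>2 (m + n) / 3\<rfloor>\<close> for an integer \<open>|W|\<close> (\<open>resolving_set_lower_bound\<close>).

  Conversely, \<open>x\<close> paths with their middle in \<open>A\<close> and \<open>y\<close> paths with their middle in \<open>B\<close> cover
  \<open>x + 2y\<close> leaves of \<open>A\<close> and \<open>2x + y\<close> of \<open>B\<close>. Because of \<open>n \<le> 2m\<close> and \<open>m \<le> n\<close>, there
  are nonnegative \<open>x\<close> and \<open>y\<close> for which these numbers are \<open>m\<close> and \<open>n\<close>, up to at most one
  uncovered leaf and one half-edge depending on \<open>m + n\<close> modulo 3 (\<open>metric_dim_upper_bound\<close>). Finally
  \<open>\<lfloor>2 (m + n) / 3\<rfloor> = n + \<lfloor>(2m - n) / 3\<rfloor>\<close>.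
\<close>

section \<open>Distances from level functions\<close>

text \<open>
  A certificate that \<open>f\<close> is the distance to \<open>w\<close>. It only speaks of single arcs, so that it can be
  verified without reasoning about walks.
\<close>

definition level_function :: "'a pair_pre_digraph \<Rightarrow> 'a \<Rightarrow> ('a \<Rightarrow> nat) \<Rightarrow> bool" where
  "level_function G w f \<longleftrightarrow> f w = 0 \<and> (\<forall>(u, v) \<in> parcs G. f u \<le> f v + 1) \<and>
     (\<forall>u \<in> pverts G. u \<noteq> w \<longrightarrow> (\<exists>v. (u, v) \<in> parcs G \<and> f u = f v + 1))"

text \<open>
  Every walk to \<open>w\<close> is at least as long as the total drop of \<open>f\<close>, and descending greedily gives a
  walk for which this is an equality.
\<close>

lemma graph_dist_eq_level:
  assumes "pair_graph G" and f: "level_function G w f"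
    and "u \<in> pverts G" and w: "w \<in> pverts G"
  shows "graph_dist G u w = ereal (real (f u))"
proof -
  interpret pair_graph G by fact
  have awalk_cost_unit: "awalk_cost (\<lambda>_. 1) p = real (length p)" for p
    by (simp add: awalk_cost_def sum_list_triv)
  have lower: "f u \<le> length p" if "awalk u p w" for p
    using that
  proof (induction p arbitrary: u)
    case Nil
    then show ?case using f by (simp add: awalk_def level_function_def)
  next
    case (Cons e p)
    obtain v where e: "e = (u, v)" and uv: "(u, v) \<in> parcs G" and "awalk v p w"
      using Cons.prems by (cases e) (auto simp: awalk_Cons_iff)
    then have "f v \<le> length p" by (intro Cons.IH)
    moreover have "f u \<le> f v + 1" using f uv by (auto simp: level_function_def)
    ultimately show ?case by simp
  qed
  have upper: "\<exists>p. awalk u p w \<and> length p = f u" if "u \<in> pverts G" for u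
    using that
  proof (induction "f u" arbitrary: u rule: less_induct)
    case less
    show ?case
    proof (cases "u = w")
      case True
      then have "awalk u [] w \<and> length [] = f u"
        using f w by (simp add: awalk_def level_function_def)
      then show ?thesis ..
    next
      case False
      then obtain v where uv: "(u, v) \<in> parcs G" and fv: "f u = f v + 1"
        using f less.prems by (auto simp: level_function_def)
      then obtain p where "awalk v p w" "length p = f v"
        using less.hyps[of v] in_arcsD2[OF uv] by auto
      then have "awalk u ((u, v) # p) w \<and> length ((u, v) # p) = f u"
        using uv fv by (simp add: awalk_Cons_iff)
      then show ?thesis ..
    qed
  qed
  obtain p where p: "awalk u p w" "length p = f u" using upper assms(3) by blast
  have "\<mu> (\<lambda>_. 1) u w = ereal (real (f u))"
  proof (rule antisym)
    show "\<mu> (\<lambda>_. 1) u w \<le> ereal (real (f u))"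
      using min_cost_le_walk_cost[OF p(1), of "\<lambda>_. 1"] p(2) by (simp add: awalk_cost_unit)
    show "ereal (real (f u)) \<le> \<mu> (\<lambda>_. 1) u w"
      unfolding \<mu>_def by (rule INF_greatest) (use lower in \<open>auto simp: awalk_cost_unit\<close>)
  qed
  then show ?thesis by (simp add: graph_dist_def)
qed

text \<open>
  An arc of the product moves in one coordinate only, so certificates add up, and so do distances.
\<close>

lemma level_function_cartesian_product:
  assumes f: "level_function G w f" and g: "level_function H z g"
  shows "level_function (G \<box> H) (w, z) (\<lambda>(u, v). f u + g v)"
  unfolding level_function_def
proof (intro conjI ballI impI)
  show "(case (w, z) of (u, v) \<Rightarrow> f u + g v) = 0"
    using f g by (simp add: level_function_def)
next
  fix e assume "e \<in> parcs (G \<box> H)"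
  moreover have "f u \<le> f u' + 1" if "(u, u') \<in> parcs G" for u u'
    using f that by (auto simp: level_function_def)
  moreover have "g v \<le> g v' + 1" if "(v, v') \<in> parcs H" for v v'
    using g that by (auto simp: level_function_def)
  ultimately show "case e of (p, q) \<Rightarrow> (case p of (u, v) \<Rightarrow> f u + g v) \<le>
      (case q of (u, v) \<Rightarrow> f u + g v) + 1"
    by (auto simp: cartesian_product_def)
next
  fix p assume p: "p \<in> pverts (G \<box> H)" "p \<noteq> (w, z)"
  obtain u v where uv: "p = (u, v)" "u \<in> pverts G" "v \<in> pverts H"
    using p(1) by (auto simp: cartesian_product_def)
  show "\<exists>q. (p, q) \<in> parcs (G \<box> H) \<and>
      (case p of (u, v) \<Rightarrow> f u + g v) = (case q of (u, v) \<Rightarrow> f u + g v) + 1"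
  proof (cases "u = w")
    case True
    then obtain v' where "(v, v') \<in> parcs H" "g v = g v' + 1"
      using g p uv unfolding level_function_def by blast
    then show ?thesis
      using uv by (intro exI[of _ "(u, v')"]) (simp add: cartesian_product_def)
  next
    case False
    then obtain u' where "(u, u') \<in> parcs G" "f u = f u' + 1"
      using f uv unfolding level_function_def by blast
    then show ?thesis
      using uv by (intro exI[of _ "(u', v)"]) (simp add: cartesian_product_def)
  qed
qed

section \<open>Products of two stars\<close>

definition is_star :: "'a pair_pre_digraph \<Rightarrow> 'a \<Rightarrow> 'a set \<Rightarrow> bool" where
  "is_star G c A \<longleftrightarrow> finite A \<and> c \<notin> A \<and> pverts G = insert c A \<and> parcs G = {c} \<times> A \<union> A \<times> {c}"

definition star_dist :: "'a \<Rightarrow> 'a \<Rightarrow> 'a \<Rightarrow> nat" where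
  "star_dist c u w = (if u = w then 0 else if u = c \<or> w = c then 1 else 2)"

lemma complete_bipartite_one_is_star:
  assumes "K\<^bsub>1,n\<^esub> (with_proj G)"
  obtains c A where "is_star G c A" "card A = n"
proof -
  obtain U A where UA: "finite (pverts G)" "pverts G = U \<union> A" "U \<inter> A = {}" "card U = 1"
      "card A = n" "parcs G = U \<times> A \<union> A \<times> U"
    using assms unfolding complete_bipartite_digraph_pair_def by blast
  obtain c where "U = {c}" using UA(4) card_1_singletonE by blast
  with UA have "is_star G c A" by (simp add: is_star_def)
  with UA(5) show ?thesis by (rule that[rotated])
qed

lemma level_function_star:
  assumes "is_star G c A" and w: "w \<in> pverts G"
  shows "level_function G w (\<lambda>u. star_dist c u w)"
proof -
  have G: "c \<notin> A" "pverts G = insert c A" "parcs G = {c} \<times> A \<union> A \<times> {c}"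
    using assms(1) by (simp_all add: is_star_def)
  have "\<exists>v. (u, v) \<in> parcs G \<and> star_dist c u w = star_dist c v w + 1"
    if u: "u \<in> pverts G" "u \<noteq> w" for u
  proof (cases "u = c")
    case True
    then have "(u, w) \<in> parcs G \<and> star_dist c u w = star_dist c w w + 1"
      using G u w by (auto simp: star_dist_def)
    then show ?thesis ..
  next
    case False
    then have "(u, c) \<in> parcs G \<and> star_dist c u w = star_dist c c w + 1"
      using G u w by (auto simp: star_dist_def)
    then show ?thesis ..
  qed
  moreover have "star_dist c u w \<le> star_dist c v w + 1" if "(u, v) \<in> parcs G" for u v
    using that G by (auto simp: star_dist_def)
  moreover have "star_dist c w w = 0" by (simp add: star_dist_def)
  ultimately show ?thesis unfolding level_function_def by blast
qed

locale star_product =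
  fixes G :: "'a pair_pre_digraph" and H :: "'b pair_pre_digraph"
    and c :: 'a and d :: 'b and A :: "'a set" and B :: "'b set"
  assumes pair_graphs: "pair_graph G" "pair_graph H"
    and stars: "is_star G c A" "is_star H d B"
begin

lemma vertices: "pverts (G \<box> H) = insert c A \<times> insert d B"
  using stars by (simp add: cartesian_product_def is_star_def)

lemma leaves: "c \<notin> A" "d \<notin> B" "finite A" "finite B"
  using stars by (simp_all add: is_star_def)

lemma pair_graph_product: "pair_graph (G \<box> H)"
  using pair_graphs by (rule pair_graph_cartesian_product)

definition prod_dist :: "'a \<times> 'b \<Rightarrow> 'a \<times> 'b \<Rightarrow> nat" where
  "prod_dist p w = star_dist c (fst p) (fst w) + star_dist d (snd p) (snd w)"

lemma star_dist_simps:
  "star_dist c c u = (if u = c then 0 else 1)" "star_dist d d v = (if v = d then 0 else 1)"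
  "a \<in> A \<Longrightarrow> star_dist c a u = (if u = a then 0 else if u = c then 1 else 2)"
  "b \<in> B \<Longrightarrow> star_dist d b v = (if v = b then 0 else if v = d then 1 else 2)"
  using leaves by (auto simp: star_dist_def)

lemma graph_dist_product:
  assumes "p \<in> pverts (G \<box> H)" and "w \<in> pverts (G \<box> H)"
  shows "graph_dist (G \<box> H) p w = ereal (real (prod_dist p w))"
proof -
  have w: "fst w \<in> pverts G" "snd w \<in> pverts H"
    using assms(2) by (auto simp: cartesian_product_def)
  have "level_function (G \<box> H) (fst w, snd w)
      (\<lambda>(u, v). star_dist c u (fst w) + star_dist d v (snd w))"
    using stars w by (intro level_function_cartesian_product level_function_star)
  from graph_dist_eq_level[OF pair_graph_product this assms(1)] assms(2)
  show ?thesis by (simp add: prod_dist_def split_beta)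
qed

lemma resolving_set_iff:
  "resolving_set (G \<box> H) W \<longleftrightarrow> W \<subseteq> pverts (G \<box> H) \<and>
     (\<forall>p \<in> pverts (G \<box> H). \<forall>q \<in> pverts (G \<box> H). p \<noteq> q \<longrightarrow> (\<exists>w \<in> W. prod_dist p w \<noteq> prod_dist q w))"
  (is "_ \<longleftrightarrow> _ \<and> ?R")
proof (cases "W \<subseteq> pverts (G \<box> H)")
  case True
  have rep: "metric_rep (G \<box> H) p ws = metric_rep (G \<box> H) q ws \<longleftrightarrow> (\<forall>w \<in> W. prod_dist p w = prod_dist q w)"
    if "set ws = W" "p \<in> pverts (G \<box> H)" "q \<in> pverts (G \<box> H)" for p q ws
    using that True by (auto simp: metric_rep_def graph_dist_product subset_iff)
  have "finite W" using True leaves by (auto simp: vertices intro: finite_subset)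
  then obtain ws where ws: "distinct ws" "set ws = W" using finite_distinct_list by metis
  show ?thesis
  proof
    assume "resolving_set (G \<box> H) W"
    then obtain vs where "set vs = W" "\<forall>p \<in> pverts (G \<box> H). \<forall>q \<in> pverts (G \<box> H). p \<noteq> q \<longrightarrow>
        metric_rep (G \<box> H) p vs \<noteq> metric_rep (G \<box> H) q vs"
      by (auto simp: resolving_set_def)
    then show "W \<subseteq> pverts (G \<box> H) \<and> ?R" using True by (simp add: rep)
  next
    assume "W \<subseteq> pverts (G \<box> H) \<and> ?R"
    then show "resolving_set (G \<box> H) W"
      unfolding resolving_set_def using ws by (intro conjI exI[of _ ws]) (simp_all add: rep)
  qed
qed (simp add: resolving_set_def)

section \<open>Resolving sets as bipartite configurations\<close>

text \<open>
  Two missed leaves \<open>a\<close>, \<open>a'\<close> would make \<open>(a, d)\<close>, \<open>(a', d)\<close> indistinguishable, and missed leaves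
  \<open>a \<in> A\<close>, \<open>b \<in> B\<close> would do the same to \<open>(a, d)\<close>, \<open>(c, b)\<close>: no landmark is closer to one of them.
\<close>

lemma resolving_misses_at_most_one_leaf:
  assumes "resolving_set (G \<box> H) W"
  shows "card (A - fst ` W) + card (B - snd ` W) \<le> 1"
proof -
  have res: "\<exists>w \<in> W. prod_dist p w \<noteq> prod_dist q w"
    if "p \<in> pverts (G \<box> H)" "q \<in> pverts (G \<box> H)" "p \<noteq> q" for p q
    using assms that by (auto simp: resolving_set_iff)
  have W: "fst w \<in> insert c A \<and> snd w \<in> insert d B" if "w \<in> W" for w
    using assms that by (auto simp: resolving_set_iff vertices)
  have "a = a'" if mem: "a \<in> A - fst ` W" "a' \<in> A - fst ` W" for a a'
  proof (rule ccontr)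
    assume "a \<noteq> a'"
    then obtain w where "w \<in> W" "prod_dist (a, d) w \<noteq> prod_dist (a', d) w"
      using res[of "(a, d)" "(a', d)"] mem by (auto simp: vertices)
    moreover from this have "fst w \<noteq> a" "fst w \<noteq> a'" using mem by auto
    ultimately show False using mem by (simp add: prod_dist_def star_dist_simps)
  qed
  then have cA: "card (A - fst ` W) \<le> 1" using leaves by (auto simp: card_le_Suc0_iff_eq)
  have "b = b'" if mem: "b \<in> B - snd ` W" "b' \<in> B - snd ` W" for b b'
  proof (rule ccontr)
    assume "b \<noteq> b'"
    then obtain w where "w \<in> W" "prod_dist (c, b) w \<noteq> prod_dist (c, b') w"
      using res[of "(c, b)" "(c, b')"] mem by (auto simp: vertices)
    moreover from this have "snd w \<noteq> b" "snd w \<noteq> b'" using mem by auto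
    ultimately show False using mem by (simp add: prod_dist_def star_dist_simps)
  qed
  then have cB: "card (B - snd ` W) \<le> 1" using leaves by (auto simp: card_le_Suc0_iff_eq)
  have "A - fst ` W = {} \<or> B - snd ` W = {}"
  proof (rule ccontr)
    assume "\<not> ?thesis"
    then obtain a b where "a \<in> A - fst ` W" "b \<in> B - snd ` W" by blast
    moreover from this obtain w where w: "w \<in> W" "prod_dist (a, d) w \<noteq> prod_dist (c, b) w"
      using res[of "(a, d)" "(c, b)"] leaves unfolding vertices by blast
    moreover have "fst w \<noteq> a" "snd w \<noteq> b" using w(1) \<open>a \<in> A - fst ` W\<close> \<open>b \<in> B - snd ` W\<close> by auto
    ultimately show False
      by (simp add: prod_dist_def star_dist_simps split: if_splits)
  qed
  then have "card (A - fst ` W) = 0 \<or> card (B - snd ` W) = 0" by (metis card.empty)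
  with cA cB show ?thesis by linarith
qed

text \<open>
  A landmark that avoids both \<open>a\<close> and \<open>b\<close> is equally far from \<open>(a, d)\<close> and \<open>(c, b)\<close>, and so is the
  landmark \<open>(a, b)\<close>. Therefore an edge \<open>(a, b)\<close> of a resolving set is never isolated.
\<close>

lemma resolving_no_isolated_edge:
  assumes "resolving_set (G \<box> H) W" and "a \<in> A" "b \<in> B"
  shows "\<exists>w \<in> W. w \<noteq> (a, b) \<and> (fst w = a \<or> snd w = b)"
proof -
  have "(a, d) \<in> pverts (G \<box> H)" "(c, b) \<in> pverts (G \<box> H)" "(a, d) \<noteq> (c, b)"
    using assms leaves by (auto simp: vertices)
  then obtain w where w: "w \<in> W" "prod_dist (a, d) w \<noteq> prod_dist (c, b) w"
    using assms(1) unfolding resolving_set_iff by blast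
  moreover have "w \<noteq> (a, b)"
  proof
    assume "w = (a, b)"
    moreover have "a \<noteq> c" "b \<noteq> d" using assms(2,3) leaves by auto
    ultimately show False using w(2) assms(2,3) by (simp add: prod_dist_def star_dist_simps)
  qed
  moreover have "fst w = a \<or> snd w = b"
    using w(2) assms(2,3) by (simp add: prod_dist_def star_dist_simps split: if_splits)
  ultimately show ?thesis by blast
qed

text \<open>
  The conditions are sufficient. Whether exactly one coordinate is a centre is the parity of a
  vertex, and every landmark sees it, so only pairs of equal parity matter: vertices that differ in
  one leaf need that one of the two leaves is met; \<open>(a, b)\<close>, \<open>(a', b')\<close> are separated by any
  landmark other than \<open>(a, b')\<close> that meets \<open>a\<close> or \<open>b'\<close>; likewise \<open>(a, d)\<close>, \<open>(c, b)\<close> by one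
  other than \<open>(a, b)\<close> that meets \<open>a\<close> or \<open>b\<close>; and \<open>(a, b)\<close>, \<open>(c, d)\<close> are separated exactly by
  landmarks containing both or neither of \<open>a\<close>, \<open>b\<close>.
\<close>

lemma resolving_setI:
  assumes W: "W \<subseteq> pverts (G \<box> H)" and ne: "A \<noteq> {}" "B \<noteq> {}"
    and missed: "card (A - fst ` W) + card (B - snd ` W) \<le> 1"
    and isolated: "\<And>a b. a \<in> A \<Longrightarrow> b \<in> B \<Longrightarrow> (a, b) \<in> W \<Longrightarrow>
           \<exists>w \<in> W. w \<noteq> (a, b) \<and> (fst w = a \<or> snd w = b)"
    and balanced: "\<And>a b. a \<in> A \<Longrightarrow> b \<in> B \<Longrightarrow> \<exists>w \<in> W. fst w = a \<longleftrightarrow> snd w = b"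
  shows "resolving_set (G \<box> H) W"
proof -
  have mem: "fst w \<in> insert c A" "snd w \<in> insert d B" if "w \<in> W" for w
    using that W by (auto simp: vertices)
  note mem = mem[of "(u, v)" for u v, simplified]
  have hitA: "\<exists>w \<in> W. fst w = a \<or> fst w = a'" if "a \<in> A" "a' \<in> A" "a \<noteq> a'" for a a'
  proof (rule ccontr)
    assume "\<not> ?thesis"
    then have "{a, a'} \<subseteq> A - fst ` W" using that by auto
    from card_mono[OF _ this] show False using missed that leaves by simp
  qed
  have hitB: "\<exists>w \<in> W. snd w = b \<or> snd w = b'" if "b \<in> B" "b' \<in> B" "b \<noteq> b'" for b b'
  proof (rule ccontr)
    assume "\<not> ?thesis"
    then have "{b, b'} \<subseteq> B - snd ` W" using that by auto
    from card_mono[OF _ this] show False using missed that leaves by simp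
  qed
  have hitAB: "\<exists>w \<in> W. fst w = a \<or> snd w = b" if "a \<in> A" "b \<in> B" for a b
  proof (rule ccontr)
    assume "\<not> ?thesis"
    then have "a \<in> A - fst ` W" "b \<in> B - snd ` W" using that by auto
    then have "A - fst ` W \<noteq> {}" "B - snd ` W \<noteq> {}" by blast+
    then have "card (A - fst ` W) > 0" "card (B - snd ` W) > 0" using leaves by
      (simp_all add: card_gt_0_iff)
    then show False using missed by simp
  qed
  define resolved where "resolved p q \<longleftrightarrow> (\<exists>w \<in> W. prod_dist p w \<noteq> prod_dist q w)" for p q
  have resolvedI: "resolved p q" if "w \<in> W" "prod_dist p w \<noteq> prod_dist q w" for p q w
    using that by (auto simp: resolved_def)
  have sym: "resolved p q" if "resolved q p" for p q
    using that unfolding resolved_def by metis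
  have touch: "\<exists>u v. (u, v) \<in> W \<and> (u, v) \<noteq> (a, b) \<and> (u = a \<or> v = b)"
    if ab: "a \<in> A" "b \<in> B" for a b
  proof -
    have "\<exists>w. w \<in> W \<and> w \<noteq> (a, b) \<and> (fst w = a \<or> snd w = b)"
    proof (cases "(a, b) \<in> W")
      case True
      then show ?thesis using isolated ab by blast
    next
      case False
      then show ?thesis using hitAB[OF ab] by metis
    qed
    then show ?thesis unfolding split_paired_Ex by simp
  qed
  have sameB: "resolved (a, y) (a', y)" if a: "a \<in> A" "a' \<in> A" "a \<noteq> a'" for a a' y
  proof -
    obtain w where "w \<in> W" "fst w = a \<or> fst w = a'" using hitA[OF a] by blast
    then show ?thesis
      using a leaves by (intro resolvedI[of w]) (auto simp: prod_dist_def star_dist_simps)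
  qed
  have sameA: "resolved (x, b) (x, b')" if b: "b \<in> B" "b' \<in> B" "b \<noteq> b'" for b b' x
  proof -
    obtain w where "w \<in> W" "snd w = b \<or> snd w = b'" using hitB[OF b] by blast
    then show ?thesis
      using b leaves by (intro resolvedI[of w]) (auto simp: prod_dist_def star_dist_simps)
  qed
  have rect: "resolved (a, b) (a', b')"
    if ab: "a \<in> A" "a' \<in> A" "a \<noteq> a'" "b \<in> B" "b' \<in> B" "b \<noteq> b'" for a a' b b'
  proof -
    obtain u v where w: "(u, v) \<in> W" "(u, v) \<noteq> (a, b')" "u = a \<or> v = b'"
      using touch[OF ab(1,5)] by blast
    then show ?thesis
      using ab leaves mem[OF w(1)]
      by (intro resolvedI[of "(u, v)"]) (auto simp: prod_dist_def star_dist_simps)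
  qed
  have odd: "resolved (a, d) (c, b)" if ab: "a \<in> A" "b \<in> B" for a b
  proof -
    obtain u v where w: "(u, v) \<in> W" "(u, v) \<noteq> (a, b)" "u = a \<or> v = b"
      using touch[OF ab] by blast
    then show ?thesis
      using ab leaves mem[OF w(1)]
      by (intro resolvedI[of "(u, v)"]) (auto simp: prod_dist_def star_dist_simps)
  qed
  have centre: "resolved (a, b) (c, d)" if ab: "a \<in> A" "b \<in> B" for a b
  proof -
    obtain u v where w: "(u, v) \<in> W" "u = a \<longleftrightarrow> v = b" using balanced[OF ab] by auto
    then show ?thesis
      using ab leaves mem[OF w(1)]
      by (intro resolvedI[of "(u, v)"]) (auto simp: prod_dist_def star_dist_simps)
  qed
  obtain w0 where w0: "w0 \<in> W" using balanced ne by blast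
  have even_star: "even (star_dist c x u) \<longleftrightarrow> (x = c) = (u = c)"
    "even (star_dist d y v) \<longleftrightarrow> (y = d) = (v = d)" for x u y v
    by (auto simp: star_dist_def)
  have even_dist: "even (prod_dist (x, y) w0) \<longleftrightarrow>
      ((x = c) = (y = d)) = ((fst w0 = c) = (snd w0 = d))" for x y
    by (auto simp: prod_dist_def even_star)
  have parity: "resolved (x, y) (x', y')"
    if "((x = c) = (y = d)) \<noteq> ((x' = c) = (y' = d))" for x y x' y'
  proof (rule resolvedI[OF w0])
    have "even (prod_dist (x, y) w0) \<noteq> even (prod_dist (x', y') w0)"
      using that unfolding even_dist by blast
    then show "prod_dist (x, y) w0 \<noteq> prod_dist (x', y') w0" by metis
  qed
  have "resolved (x, y) (x', y')"
    if V: "x \<in> insert c A" "y \<in> insert d B" "x' \<in> insert c A" "y' \<in> insert d B"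
      and neq: "(x, y) \<noteq> (x', y')" for x y x' y'
  proof (cases "((x = c) = (y = d)) = ((x' = c) = (y' = d))")
    case False
    then show ?thesis by (rule parity)
  next
    case same: True
    show ?thesis
    proof (cases "x = c"; cases "x' = c")
      assume "x = c" "x' = c"
      then have "y \<in> B" "y' \<in> B" "y \<noteq> y'" using same V neq by auto
      then show ?thesis using sameA \<open>x = c\<close> \<open>x' = c\<close> by simp
    next
      assume x: "x = c" "x' \<noteq> c"
      then have "x' \<in> A" "y = d \<and> y' \<in> B \<or> y \<in> B \<and> y' = d" using same V by auto
      then show ?thesis using sym[OF odd] sym[OF centre] x by blast
    next
      assume x: "x \<noteq> c" "x' = c"
      then have "x \<in> A" "y = d \<and> y' \<in> B \<or> y \<in> B \<and> y' = d" using same V by auto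
      then show ?thesis using odd centre x by blast
    next
      assume x: "x \<noteq> c" "x' \<noteq> c"
      then have A: "x \<in> A" "x' \<in> A" and y: "y = y' \<or> y \<in> B \<and> y' \<in> B" using same V by auto
      show ?thesis
      proof (cases "x = x' \<or> y = y'")
        case True
        then show ?thesis using sameA sameB A y neq by auto
      next
        case False
        then show ?thesis using rect A y by blast
      qed
    qed
  qed
  then show ?thesis
    using W unfolding resolving_set_iff vertices resolved_def by blast
qed

end

section \<open>The lower bound\<close>

text \<open>
  Every value of \<open>f\<close> carries one unit of charge, which is shared evenly by its preimages.
\<close>

lemma card_image_eq_sum_inverse_fibres:
  assumes "finite S"
  shows "real (card (f ` S)) = (\<Sum>s \<in> S. 1 / real (card {t \<in> S. f t = f s}))"
proof -
  have "(\<Sum>s \<in> S. 1 / real (card {t \<in> S. f t = f s}))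
      = (\<Sum>y \<in> f ` S. \<Sum>s \<in> {s \<in> S. f s = y}. 1 / real (card {t \<in> S. f t = f s}))"
    using assms by (rule sum.image_gen)
  also have "\<dots> = (\<Sum>y \<in> f ` S. 1)"
  proof (rule sum.cong)
    fix y assume "y \<in> f ` S"
    then have "card {t \<in> S. f t = y} > 0" using assms by (auto simp: card_gt_0_iff)
    then show "(\<Sum>s \<in> {s \<in> S. f s = y}. 1 / real (card {t \<in> S. f t = f s})) = 1" by simp
  qed simp
  finally show ?thesis by simp
qed

context star_product
begin

text \<open>
  Each met leaf distributes a unit of charge among its landmarks, and \<open>\<alpha> w\<close> and \<open>\<beta> w\<close> are what
  \<open>w\<close> gets from its leaf in \<open>A\<close> and in \<open>B\<close>. A half-edge gets at most 1. An edge is not isolated,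
  so that one of its ends is shared with another landmark and contributes at most \<open>1/2\<close>.
\<close>

lemma resolving_set_lower_bound:
  assumes res: "resolving_set (G \<box> H) W"
  shows "2 * (card A + card B) \<le> 3 * card W + 2"
proof -
  have W: "W \<subseteq> insert c A \<times> insert d B" using res by (simp add: resolving_set_iff vertices)
  then have fin: "finite W" using leaves by (auto intro: finite_subset)
  define \<alpha> where "\<alpha> = (\<lambda>w :: 'a \<times> 'b. if fst w \<in> A then 1 / real (card {t \<in> W. fst t = fst w}) else 0)"
  define \<beta> where "\<beta> = (\<lambda>w :: 'a \<times> 'b. if snd w \<in> B then 1 / real (card {t \<in> W. snd t = snd w}) else 0)"
  have one: "card T \<ge> 1" if "w \<in> T" "T \<subseteq> W" for w T
    using that fin by (metis One_nat_def Suc_leI card_gt_0_iff empty_iff finite_subset)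
  have two: "card T \<ge> 2" if "w \<in> T" "w' \<in> T" "w \<noteq> w'" "T \<subseteq> W" for w w' T
    using card_mono[of T "{w, w'}"] that fin finite_subset by fastforce
  have inv1: "1 / real k \<le> 1" if "k \<ge> 1" for k :: nat using that by simp
  have inv2: "1 / real k \<le> 1 / 2" if "k \<ge> 2" for k :: nat using that by (simp add: field_simps)
  have \<alpha>1: "\<alpha> w \<le> 1" and \<beta>1: "\<beta> w \<le> 1" if "w \<in> W" for w
    using that unfolding \<alpha>_def \<beta>_def by (auto intro!: inv1 one[of w])
  have charge: "\<alpha> w + \<beta> w \<le> 3 / 2" if w: "w \<in> W" for w
  proof (cases "fst w \<in> A \<and> snd w \<in> B")
    case True
    then obtain w' where w': "w' \<in> W" "w' \<noteq> w" "fst w' = fst w \<or> snd w' = snd w"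
      using resolving_no_isolated_edge[OF res, of "fst w" "snd w"] by auto
    then have "\<alpha> w \<le> 1 / 2 \<or> \<beta> w \<le> 1 / 2"
    proof (elim disjE)
      assume "fst w' = fst w"
      then have "card {t \<in> W. fst t = fst w} \<ge> 2" using w w' by (intro two[of w _ w']) auto
      from inv2[OF this] show ?thesis by (simp add: \<alpha>_def)
    next
      assume "snd w' = snd w"
      then have "card {t \<in> W. snd t = snd w} \<ge> 2" using w w' by (intro two[of w _ w']) auto
      from inv2[OF this] show ?thesis by (simp add: \<beta>_def)
    qed
    with \<alpha>1[OF w] \<beta>1[OF w] show ?thesis by linarith
  next
    case False
    then have "\<alpha> w = 0 \<or> \<beta> w = 0" by (auto simp: \<alpha>_def \<beta>_def)
    with \<alpha>1[OF w] \<beta>1[OF w] show ?thesis by linarith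
  qed
  have "real (card (A \<inter> fst ` W)) = (\<Sum>w \<in> {w \<in> W. fst w \<in> A}. \<alpha> w)"
  proof -
    have "A \<inter> fst ` W = fst ` {w \<in> W. fst w \<in> A}" by auto
    moreover have "{t \<in> {w \<in> W. fst w \<in> A}. fst t = fst s} = {t \<in> W. fst t = fst s}"
      if "fst s \<in> A" for s :: "'a \<times> 'b" using that by auto
    ultimately show ?thesis
      using card_image_eq_sum_inverse_fibres[of "{w \<in> W. fst w \<in> A}" fst] fin
      by (simp add: \<alpha>_def)
  qed
  also have "\<dots> = (\<Sum>w \<in> W. \<alpha> w)"
    using fin by (intro sum.mono_neutral_left) (auto simp: \<alpha>_def)
  finally have sA: "real (card (A \<inter> fst ` W)) = (\<Sum>w \<in> W. \<alpha> w)" .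
  have "real (card (B \<inter> snd ` W)) = (\<Sum>w \<in> {w \<in> W. snd w \<in> B}. \<beta> w)"
  proof -
    have "B \<inter> snd ` W = snd ` {w \<in> W. snd w \<in> B}" by auto
    moreover have "{t \<in> {w \<in> W. snd w \<in> B}. snd t = snd s} = {t \<in> W. snd t = snd s}"
      if "snd s \<in> B" for s :: "'a \<times> 'b" using that by auto
    ultimately show ?thesis
      using card_image_eq_sum_inverse_fibres[of "{w \<in> W. snd w \<in> B}" snd] fin
      by (simp add: \<beta>_def)
  qed
  also have "\<dots> = (\<Sum>w \<in> W. \<beta> w)"
    using fin by (intro sum.mono_neutral_left) (auto simp: \<beta>_def)
  finally have sB: "real (card (B \<inter> snd ` W)) = (\<Sum>w \<in> W. \<beta> w)" .
  have "real (card (A \<inter> fst ` W) + card (B \<inter> snd ` W)) = (\<Sum>w \<in> W. \<alpha> w + \<beta> w)"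
    by (simp add: sA sB sum.distrib)
  also have "\<dots> \<le> (\<Sum>w \<in> W. 3 / 2)" by (intro sum_mono charge)
  finally have "2 * (card (A \<inter> fst ` W) + card (B \<inter> snd ` W)) \<le> 3 * card W" by simp
  moreover have "card A = card (A \<inter> fst ` W) + card (A - fst ` W)"
    "card B = card (B \<inter> snd ` W) + card (B - snd ` W)"
    using leaves by (simp_all add: card_Int_Diff)
  ultimately have "2 * (card A + card B) \<le>
      3 * card W + 2 * (card (A - fst ` W) + card (B - snd ` W))"
    by (simp only: distrib_left)
  also have "\<dots> \<le> 3 * card W + 2 * 1"
    using resolving_misses_at_most_one_leaf[OF res] by (intro add_mono mult_le_mono order.refl)
  finally show ?thesis by simp
qed

end

section \<open>The construction\<close>

text \<open>
  For injective \<open>a\<close>, \<open>b\<close> these are vertex-disjoint paths with two edges, written edge by edge: \<open>x\<close> paths with middle \<open>a i\<close> and ends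
  \<open>b (2 i)\<close>, \<open>b (2 i + 1)\<close>, then, on the leaves not used by these, \<open>y\<close> paths with middle in the
  range of \<open>b\<close> and ends in the range of \<open>a\<close>.
\<close>

definition path_packing :: "(nat \<Rightarrow> 'a) \<Rightarrow> (nat \<Rightarrow> 'b) \<Rightarrow> nat \<Rightarrow> nat \<Rightarrow> ('a \<times> 'b) set" where
  "path_packing a b x y = (\<lambda>j. (a (j div 2), b j)) ` {..<2 * x} \<union>
     (\<lambda>j. (a (x + j), b (2 * x + j div 2))) ` {..<2 * y}"

lemma path_packing_leftI: "j < 2 * x \<Longrightarrow> (a (j div 2), b j) \<in> path_packing a b x y"
  unfolding path_packing_def by blast

lemma path_packing_rightI: "j < 2 * y \<Longrightarrow> (a (x + j), b (2 * x + j div 2)) \<in> path_packing a b x y"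
  unfolding path_packing_def by blast

lemma card_path_packing: "card (path_packing a b x y) \<le> 2 * x + 2 * y"
  unfolding path_packing_def by (rule order.trans[OF card_Un_le], rule add_mono)
    (rule order.trans[OF card_image_le]; simp)+

lemma fst_path_packing: "fst ` path_packing a b x y = a ` {..<x + 2 * y}"
proof -
  have "(\<lambda>j. j div 2) ` {..<2 * x} = {..<x}"
    by (auto simp: image_iff intro!: bexI[of _ "2 * _"])
  moreover have "(\<lambda>j. x + j) ` {..<2 * y} = {x..<x + 2 * y}"
    using image_add_atLeastLessThan[of x 0 "2 * y"] by (simp add: atLeast0LessThan add.commute)
  moreover have "fst ` path_packing a b x y = a ` ((\<lambda>j. j div 2) ` {..<2 * x} \<union> (\<lambda>j. x + j) ` {..<2 * y})"
    by (simp add: path_packing_def image_Un image_image)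
  ultimately show ?thesis by (simp add: ivl_disj_un)
qed

lemma snd_path_packing: "snd ` path_packing a b x y = b ` {..<2 * x + y}"
proof -
  have "(\<lambda>j. 2 * x + j) ` (\<lambda>j. j div 2) ` {..<2 * y} = {2 * x..<2 * x + y}"
  proof -
    have "(\<lambda>j. j div 2) ` {..<2 * y} = {..<y}"
      by (auto simp: image_iff intro!: bexI[of _ "2 * _"])
    then show ?thesis
      using image_add_atLeastLessThan[of "2 * x" 0 y] by (simp add: atLeast0LessThan add.commute)
  qed
  moreover have "snd ` path_packing a b x y = b ` ({..<2 * x} \<union> (\<lambda>j. 2 * x + j) ` (\<lambda>j. j div 2) ` {..<2 * y})"
    by (simp add: path_packing_def image_Un image_image)
  ultimately show ?thesis by (simp add: ivl_disj_un)
qed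

lemma path_packing_no_isolated_edge:
  assumes a: "inj_on a {..<m}" and b: "inj_on b {..<n}"
    and xy: "x + 2 * y \<le> m" "2 * x + y \<le> n" and w: "w \<in> path_packing a b x y"
  shows "\<exists>w' \<in> path_packing a b x y. w' \<noteq> w \<and> (fst w' = fst w \<or> snd w' = snd w)"
proof -
  \<comment> \<open>the edges number \<open>2 i\<close> and \<open>2 i + 1\<close> form one path\<close>
  define sib :: "nat \<Rightarrow> nat" where "sib j = (if even j then j + 1 else j - 1)" for j
  have sib: "sib j < 2 * k" "sib j div 2 = j div 2" "sib j \<noteq> j" if "j < 2 * k" for j k
    using that by (auto simp: sib_def elim!: evenE oddE)
  from w consider j where "j < 2 * x" "w = (a (j div 2), b j)"
    | j where "j < 2 * y" "w = (a (x + j), b (2 * x + j div 2))"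
    by (auto simp: path_packing_def)
  then show ?thesis
  proof cases
    case 1
    then have "b (sib j) \<noteq> b j" using sib[of j x] xy by (auto dest: inj_onD[OF b])
    moreover have "(a (j div 2), b (sib j)) \<in> path_packing a b x y"
      using path_packing_leftI[of "sib j" x a b y] sib[OF 1(1)] by simp
    ultimately show ?thesis using 1 by (metis fst_conv snd_conv)
  next
    case 2
    then have "a (x + sib j) \<noteq> a (x + j)" using sib[of j y] xy by (auto dest: inj_onD[OF a])
    moreover have "(a (x + sib j), b (2 * x + j div 2)) \<in> path_packing a b x y"
      using path_packing_rightI[of "sib j" y a x b] sib[OF 2(1)] by simp
    ultimately show ?thesis using 2 by (metis fst_conv snd_conv)
  qed
qed

context star_product
begin

text \<open>
  Half-edges \<open>E\<close> serve to cover a few more leaves. What remains to be excluded are leaves \<open>p\<close>, \<open>q\<close>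
  such that each landmark contains exactly one of them. As \<open>q\<close> is on at most one edge of a path with
  middle in \<open>A\<close>, this forces \<open>p\<close> to be the middle of every such path, and similarly \<open>q\<close> is the
  middle of every path of the other kind. Each alternative of the last hypothesis contradicts that:
  two middles on one side, no candidate for \<open>q\<close> besides the ends of the path at \<open>p\<close>, or a half-edge
  at some leaf of \<open>A\<close> other than \<open>p\<close>.
\<close>

lemma resolving_set_path_packing:
  assumes a: "bij_betw a {..<m} A" and b: "bij_betw b {..<n} B"
    and x: "0 < x" and xy: "x + 2 * y \<le> m" "2 * x + y \<le> n"
    and E: "E \<subseteq> A \<times> {d} \<union> {c} \<times> B"
    and missed: "card (a ` {x + 2 * y..<m} - fst ` E) + card (b ` {2 * x + y..<n} - snd ` E) \<le> 1"
    and unbalanced: "2 \<le> x \<or> 2 \<le> y \<or> n = 2 \<or> (\<exists>i. 0 < i \<and> i < m \<and> (a i, d) \<in> E)"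
  shows "resolving_set (G \<box> H) (path_packing a b x y \<union> E)"
proof (rule resolving_setI)
  have a_inj: "a i = a j \<longleftrightarrow> i = j" if "i < m" "j < m" for i j
    using a that by (auto simp: bij_betw_def inj_on_def)
  have b_inj: "b i = b j \<longleftrightarrow> i = j" if "i < n" "j < n" for i j
    using b that by (auto simp: bij_betw_def inj_on_def)
  have aA: "A = a ` {..<m}" and bB: "B = b ` {..<n}"
    using a b by (auto simp: bij_betw_def)
  have "{..<m} = {..<x + 2 * y} \<union> {x + 2 * y..<m}" "{..<n} = {..<2 * x + y} \<union> {2 * x + y..<n}"
    using xy by auto
  then have cover: "A = fst ` path_packing a b x y \<union> a ` {x + 2 * y..<m}"
    "B = snd ` path_packing a b x y \<union> b ` {2 * x + y..<n}"
    unfolding aA bB fst_path_packing snd_path_packing image_Un[symmetric] by simp_all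
  have sub: "path_packing a b x y \<subseteq> A \<times> B"
    by (rule subset_trans[OF subset_fst_snd Sigma_mono]) (subst cover; blast)+
  then show "path_packing a b x y \<union> E \<subseteq> pverts (G \<box> H)" using E unfolding vertices by blast
  show "A \<noteq> {}" "B \<noteq> {}" using x xy by (auto simp: aA bB lessThan_empty_iff)
  have "A - fst ` (path_packing a b x y \<union> E) \<subseteq> a ` {x + 2 * y..<m} - fst ` E"
    unfolding cover image_Un by blast
  then have "card (A - fst ` (path_packing a b x y \<union> E)) \<le> card (a ` {x + 2 * y..<m} - fst ` E)"
    by (rule card_mono[rotated]) simp
  moreover have "B - snd ` (path_packing a b x y \<union> E) \<subseteq> b ` {2 * x + y..<n} - snd ` E"
    unfolding cover image_Un by blast
  then have "card (B - snd ` (path_packing a b x y \<union> E)) \<le> card (b ` {2 * x + y..<n} - snd ` E)"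
    by (rule card_mono[rotated]) simp
  ultimately show "card (A - fst ` (path_packing a b x y \<union> E)) +
      card (B - snd ` (path_packing a b x y \<union> E)) \<le> 1"
    using missed by linarith
  show "\<exists>w \<in> path_packing a b x y \<union> E. w \<noteq> (p, q) \<and> (fst w = p \<or> snd w = q)"
    if "p \<in> A" "q \<in> B" "(p, q) \<in> path_packing a b x y \<union> E" for p q
  proof -
    have "(p, q) \<in> path_packing a b x y" using that E leaves by auto
    from path_packing_no_isolated_edge[OF bij_betw_imp_inj_on[OF a] bij_betw_imp_inj_on[OF b] xy this]
    obtain w where "w \<in> path_packing a b x y" "w \<noteq> (p, q)" "fst w = p \<or> snd w = q" by auto
    then show ?thesis by blast
  qed
  show "\<exists>w \<in> path_packing a b x y \<union> E. fst w = p \<longleftrightarrow> snd w = q" if pq: "p \<in> A" "q \<in> B" for p q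
  proof (rule ccontr)
    assume "\<not> ?thesis"
    then have once: "fst w = p \<longleftrightarrow> snd w \<noteq> q" if "w \<in> path_packing a b x y \<union> E" for w
      using that by blast
    have centreA: "p = a i" if "i < x" for i
    proof -
      have "(a i, b (2 * i)) \<in> path_packing a b x y" "(a i, b (2 * i + 1)) \<in> path_packing a b x y"
        using that path_packing_leftI[of "2 * i" x a b y]
          path_packing_leftI[of "2 * i + 1" x a b y] by simp_all
      moreover have "b (2 * i) \<noteq> b (2 * i + 1)" using that xy b_inj[of "2 * i" "2 * i + 1"] by simp
      ultimately show ?thesis using once by (metis UnI1 fst_conv snd_conv)
    qed
    have centreB: "q = b (2 * x + i)" if "i < y" for i
    proof -
      have "(a (x + 2 * i), b (2 * x + i)) \<in> path_packing a b x y"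
        "(a (x + (2 * i + 1)), b (2 * x + i)) \<in> path_packing a b x y"
        using that path_packing_rightI[of "2 * i" y a x b]
          path_packing_rightI[of "2 * i + 1" y a x b] by simp_all
      moreover have "a (x + 2 * i) \<noteq> a (x + (2 * i + 1))"
        using that xy a_inj[of "x + 2 * i" "x + (2 * i + 1)"] by simp
      ultimately show ?thesis using once by (metis UnI1 fst_conv snd_conv)
    qed
    have p0: "p = a 0" using centreA x by blast
    from unbalanced show False
    proof (elim disjE exE)
      assume "2 \<le> x"
      then show False using p0 centreA[of 1] a_inj[of 0 1] xy by simp
    next
      assume "2 \<le> y"
      then show False using centreB[of 0] centreB[of 1] b_inj[of "2 * x" "2 * x + 1"] xy by simp
    next
      assume n: "n = 2"
      have "(a 0, b 0) \<in> path_packing a b x y" "(a 0, b 1) \<in> path_packing a b x y"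
        using x path_packing_leftI[of 0 x a b y] path_packing_leftI[of 1 x a b y] by simp_all
      then have "q \<noteq> b 0" "q \<noteq> b 1" using once p0 by force+
      moreover obtain j where "j < 2" "q = b j" using pq(2) n by (auto simp: bB)
      ultimately show False by (auto simp: less_2_cases_iff)
    next
      fix i assume "0 < i \<and> i < m \<and> (a i, d) \<in> E"
      then show False using once[of "(a i, d)"] p0 a_inj[of i 0] pq(2) leaves by auto
    qed
  qed
qed

lemma metric_dim_le:
  assumes "resolving_set (G \<box> H) W"
  shows "metric_dim (G \<box> H) \<le> card W"
  unfolding metric_dim_def by (rule Least_le) (use assms in blast)

text \<open>
  Solving \<open>x + 2y = m\<close> and \<open>2x + y = n\<close> with \<open>m + n = 3q\<close> gives \<open>x = n - q\<close> and \<open>y = m - q\<close>. For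
  other residues of \<open>m + n\<close> one leaf of \<open>A\<close> is set aside and missed, or one leaf on each side is
  set aside, of which one gets a half-edge and the other is missed. For \<open>m = n = 3\<close> the packing
  \<open>x = y = 1\<close> violates the third condition at the two middles, and one path with two half-edges
  takes its place.
\<close>

lemma metric_dim_upper_bound:
  assumes m: "card A = m" and n: "card B = n" and "0 < m"
    and ne: "(m, n) \<noteq> (1, 1)" and mn: "n \<le> 2 * m" "m \<le> n"
  shows "metric_dim (G \<box> H) \<le> 2 * (m + n) div 3"
proof -
  obtain a b where a: "bij_betw a {..<m} A" and b: "bij_betw b {..<n} B"
    using ex_bij_betw_nat_finite[OF leaves(3)] ex_bij_betw_nat_finite[OF leaves(4)] m n
    by (auto simp: atLeast0LessThan)
  have aA: "a i \<in> A" if "i < m" for i using a that by (auto simp: bij_betw_def)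
  have bB: "b i \<in> B" if "i < n" for i using b that by (auto simp: bij_betw_def)
  have le: "metric_dim (G \<box> H) \<le> 2 * x + 2 * y + card E"
    if "resolving_set (G \<box> H) (path_packing a b x y \<union> E)" for x y E
    using metric_dim_le[OF that] card_path_packing[of a b x y]
      card_Un_le[of "path_packing a b x y" E] by linarith
  define q where "q = (m + n) div 3"
  have "m + n = 3 * q + (m + n) mod 3" by (simp add: q_def)
  moreover have "(m + n) mod 3 < 3" by simp
  ultimately consider (exc) "m = 3" "n = 3" | (r0) "m + n = 3 * q" "(m, n) \<noteq> (3, 3)"
    | (r1) "m + n = 3 * q + 1" | (r2) "m + n = 3 * q + 2"
    by fastforce
  then show ?thesis
  proof cases
    case exc
    have "resolving_set (G \<box> H) (path_packing a b 1 0 \<union> {(a 1, d), (c, b 2)})"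
    proof (rule resolving_set_path_packing[OF a b])
      have "a ` {1 + 2 * 0..<m} - fst ` {(a 1, d), (c, b 2)} \<subseteq> {a 2}"
        using exc by (auto simp: less_Suc_eq numeral_eq_Suc)
      from card_mono[OF _ this] have "card (a ` {1 + 2 * 0..<m} - fst ` {(a 1, d), (c, b 2)}) \<le> 1"
        by simp
      moreover have "b ` {2 * 1 + 0..<n} - snd ` {(a 1, d), (c, b 2)} = {}"
        using exc by (auto simp: less_Suc_eq numeral_eq_Suc)
      ultimately show "card (a ` {1 + 2 * 0..<m} - fst ` {(a 1, d), (c, b 2)})
          + card (b ` {2 * 1 + 0..<n} - snd ` {(a 1, d), (c, b 2)}) \<le> 1"
        by (metis add.right_neutral card.empty)
      show "{(a 1, d), (c, b 2)} \<subseteq> A \<times> {d} \<union> {c} \<times> B" using aA bB exc by auto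
    qed (use exc in auto)
    from le[OF this] show ?thesis
      using exc card_insert_le_m1[of 2 "{(c, b 2)}" "(a 1, d)"] by simp
  next
    case r0
    define x where "x = n - q"
    define y where "y = m - q"
    have xy: "x + 2 * y = m" "2 * x + y = n" "0 < x"
      using r0(1) mn \<open>0 < m\<close> unfolding x_def y_def by linarith+
    moreover have "2 \<le> x \<or> 2 \<le> y \<or> n = 2"
    proof (rule ccontr)
      assume "\<not> ?thesis"
      then have "x = 1" "y = 0 \<or> y = 1" "n \<noteq> 2" using xy(3) by linarith+
      then show False using xy(1,2) r0(2) by auto
    qed
    ultimately have "resolving_set (G \<box> H) (path_packing a b x y \<union> {})"
      by (intro resolving_set_path_packing[OF a b]) auto
    from le[OF this] have "metric_dim (G \<box> H) \<le> 2 * q" using xy r0(1) by simp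
    then show ?thesis using r0(1) by (simp add: less_eq_div_iff_mult_less_eq)
  next
    case r1
    define x where "x = n - q"
    define y where "y = m - 1 - q"
    have xy: "x + 2 * y + 1 = m" "2 * x + y = n" "0 < x"
      using r1 mn \<open>0 < m\<close> unfolding x_def y_def by linarith+
    moreover have "2 \<le> x \<or> n = 2" using xy mn by linarith
    moreover have "{x + 2 * y..<m} = {m - 1}" using xy(1) by auto
    ultimately have "resolving_set (G \<box> H) (path_packing a b x y \<union> {})"
      by (intro resolving_set_path_packing[OF a b]) auto
    from le[OF this] have "metric_dim (G \<box> H) \<le> 2 * q" using xy r1 by simp
    then show ?thesis using r1 by (simp add: less_eq_div_iff_mult_less_eq)
  next
    case r2
    define x where "x = n - 1 - q"
    define y where "y = m - 1 - q"
    have xy: "x + 2 * y + 1 = m" "2 * x + y + 1 = n"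
      using r2 mn \<open>0 < m\<close> unfolding x_def y_def by linarith+
    moreover have "0 < x"
    proof (rule ccontr)
      assume "\<not> ?thesis"
      then have "m = 1" "n = 1" using xy mn by linarith+
      then show False using ne by simp
    qed
    moreover have "{x + 2 * y..<m} = {x + 2 * y}" "{2 * x + y..<n} = {2 * x + y}"
      using xy by auto
    ultimately have "resolving_set (G \<box> H) (path_packing a b x y \<union> {(a (x + 2 * y), d)})"
      using aA[of "x + 2 * y"] card_Diff1_le[of "{b (2 * x + y)}" d]
      by (intro resolving_set_path_packing[OF a b]) (auto intro!: exI[of _ "x + 2 * y"])
    from le[OF this] have "metric_dim (G \<box> H) \<le> 2 * q + 1" using xy r2 by simp
    then show ?thesis using r2 by (simp add: less_eq_div_iff_mult_less_eq)
  qed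
qed

end

theorem theorem4:
  fixes G :: "'a pair_pre_digraph" and H :: "'b pair_pre_digraph" and m n :: nat
  assumes "0 < m" and "0 < n"
    and "(m, n) \<noteq> (1, 1)"
    and "real n / 2 \<le> real m" and "m \<le> n"
    and "K\<^bsub>1,m\<^esub> (with_proj G)" and "K\<^bsub>1,n\<^esub> (with_proj H)"
  shows "int (metric_dim (G \<box> H)) = int n + \<lfloor>(2 * real m - real n) / 3\<rfloor>"
proof -
  obtain c A where A: "is_star G c A" "card A = m"
    using complete_bipartite_one_is_star[OF assms(6)] .
  obtain d B where B: "is_star H d B" "card B = n"
    using complete_bipartite_one_is_star[OF assms(7)] .
  interpret star_product G H c d A B
    using star_product.intro[OF pair_graphI_complete_bipartite[OF assms(6)]
        pair_graphI_complete_bipartite[OF assms(7)] A(1) B(1)] .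
  obtain W where W: "resolving_set (G \<box> H) W" "card W = metric_dim (G \<box> H)"
    using metric_dim_attained[OF pair_graph_product] .
  have "2 * (m + n) \<le> 3 * metric_dim (G \<box> H) + 2"
    using resolving_set_lower_bound[OF W(1)] W(2) A(2) B(2) by simp
  moreover have "metric_dim (G \<box> H) \<le> 2 * (m + n) div 3"
    using metric_dim_upper_bound[OF A(2) B(2)] assms by simp
  ultimately have "metric_dim (G \<box> H) = 2 * (m + n) div 3" by linarith
  moreover have "\<lfloor>(2 * real m - real n) / 3\<rfloor> = (2 * int m - int n) div 3"
    using floor_divide_of_int_eq[of "2 * int m - int n" 3, where 'a = real] by simp
  ultimately show ?thesis by presburger
qed

end
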